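(* Let $\Omega\subset\mathbb{R}^D$ be a bounded domain with $|\Omega|>0$ and let $\omega\in L^\infty(\Omega)$. Fix a polynomial degree $d\ge 0$, and for each $N$ consider $N$ distinct data points in $\Omega$, a radial basis function $\varphi$ and shape parameters, with associated matrices $\Phi$ and $P$, cubature weights $\mathbf{w}$ of the radial basis function cubature formula (RBF-CF) augmented with polynomials of degree $d$, cubature weights $\hat{\mathbf{w}}$ of the pure RBF-CF without polynomials, and $B$, $\boldsymbol{\tau}$ (all depending on $N$ and defined in the context). Assume that $\Phi$ and $P$ have full rank and that $$\|B\boldsymbol{\tau}(\cdot)\|_{\ell^1}\to 0\ \text{ in } L^1(\Omega)\quad\text{as } N\to\infty,\qquad\text{i.e.}\qquad \int_\Omega\|B\boldsymbol{\tau}(\boldsymbol{x})\|_{\ell^1}\,d\boldsymbol{x}\to0.$$ Then the following two statements are equivalent: (a) $\|\hat{\mathbf{w}}\|_{\ell^1}\to\|I\|_\infty$ for $N\to\infty$; (b) $\|\mathbf{w}\|_{\ell^1}\to\|I\|_\infty$ for $N\to\infty$. That is, either both the pure and the polynomial augmented RBF-CF are asymptotically stable or neither is.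
   Context: Notation: $I[g]=\int_\Omega g(\boldsymbol{x})\omega(\boldsymbol{x})\,d\boldsymbol{x}$ (applied componentwise to vector-valued functions), and $\|I\|_\infty=I[1]$. For given $N$, let $\mathbf{x}_1,\dots,\mathbf{x}_N\in\Omega$ be distinct data points, $\varphi:\mathbb{R}_0^+\to\mathbb{R}$ a radial basis function, $\varepsilon_1,\dots,\varepsilon_N$ nonnegative shape parameters, $\varphi_n(\boldsymbol{x})=\varphi(\varepsilon_n\|\boldsymbol{x}-\mathbf{x}_n\|_2)$ (assumed integrable on $\Omega$, so that all integrals below exist), and $p_1,\dots,p_K$ a basis of the space $\mathbb{P}_d(\Omega)$ of algebraic polynomials of degree at most $d$. Set $\Phi=(\varphi_j(\mathbf{x}_i))_{i,j=1}^N\in\mathbb{R}^{N\times N}$ and $P=(p_k(\mathbf{x}_n))_{n,k}\in\mathbb{R}^{N\times K}$. Full rank means that $\Phi$ is invertible and $P$ has full column rank $K$ (equivalently, the data points are $\mathbb{P}_d(\Omega)$-unisolvent); these assumptions are understood for all sufficiently large $N$. Augmented cardinal functions: $c_m=\sum_{n=1}^N\alpha_n^{(m)}\varphi_n+\sum_{k=1}^K\beta_k^{(m)}p_k$, $m=1,\dots,N$, determined by $c_m(\mathbf{x}_n)=\delta_{mn}$ for $n=1,\dots,N$ and $\sum_{n=1}^N\alpha_n^{(m)}p_k(\mathbf{x}_n)=0$ for $k=1,\dots,K$. Pure cardinal functions: $\hat c_m=\sum_{n=1}^N\hat\alpha_n^{(m)}\varphi_n$ with $\hat c_m(\mathbf{x}_n)=\delta_{mn}$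 (no polynomial terms). Write $\hat{\mathbf{c}}(\boldsymbol{x})=[\hat c_1(\boldsymbol{x}),\dots,\hat c_N(\boldsymbol{x})]^T$ and $\mathbf{p}(\boldsymbol{x})=[p_1(\boldsymbol{x}),\dots,p_K(\boldsymbol{x})]^T$. Weights: $\mathbf{w}=[I[c_1],\dots,I[c_N]]^T$ and $\hat{\mathbf{w}}=[I[\hat c_1],\dots,I[\hat c_N]]^T$. Definitions of $B$ and $\boldsymbol{\tau}$: $$B=\Phi^{-1}P\,(P^T\Phi^{-1}P)^{-1}\in\mathbb{R}^{N\times K},\qquad \boldsymbol{\tau}(\boldsymbol{x})=P^T\hat{\mathbf{c}}(\boldsymbol{x})-\mathbf{p}(\boldsymbol{x})\in\mathbb{R}^K,$$ where $P^T\Phi^{-1}P$ is understood to be invertible, so that $B$ is defined. A sequence of cubature formulas with weight vectors $\mathbf{w}_N\in\mathbb{R}^N$ is called asymptotically stable if $\|\mathbf{w}_N\|_{\ell^1}\to\|I\|_\infty$ for $N\to\infty$.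
   Formalization: Φ is taken transposed (row = kernel j, column = point i) in the definition of B, since for unequal shape parameters (nonsymmetric Φ) the claim fails with rows as points; for symmetric Φ, e.g. equal shape parameters, nothing changes. *)

theory Defs
  imports
    "HOL-Analysis.Analysis"
    "Jordan_Normal_Form.Gauss_Jordan_Elimination"
    "Jordan_Normal_Form.DL_Rank"
begin

no_notation Finite_Cartesian_Product.vec_nth (infixl \<open>$\<close> 90)

text \<open>
  Points of the \<open>D\<close>-dimensional Euclidean space have type \<^typ>\<open>real ^ 'n\<close>. The matrices and
  vectors whose size depends on the number \<open>N\<close> of data points are Jordan\_Normal\_Form matrices
  and vectors. All indices start at \<open>0\<close>: data points, kernels and weights are indexed by
  \<open>{..<N}\<close>, the polynomial basis by \<open>{..<K}\<close>.
\<close>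

definition Linfty :: "(real ^ 'n) set \<Rightarrow> (real ^ 'n \<Rightarrow> real) set" where
  "Linfty \<Omega> = {\<omega>. \<omega> \<in> borel_measurable (lebesgue_on \<Omega>) \<and>
                  (\<exists>C. AE y in lebesgue_on \<Omega>. \<bar>\<omega> y\<bar> \<le> C)}"

definition wint :: "(real ^ 'n) set \<Rightarrow> (real ^ 'n \<Rightarrow> real) \<Rightarrow> (real ^ 'n \<Rightarrow> real) \<Rightarrow> real" where
  "wint \<Omega> \<omega> g = (LINT y|lebesgue_on \<Omega>. g y * \<omega> y)"

text \<open>The quantity \<open>\<parallel>I\<parallel>\<^sub>\<infinity>\<close> is by convention \<open>I[1]\<close>; no sign condition is imposed on \<open>\<omega>\<close>.\<close>

definition wint_norm :: "(real ^ 'n) set \<Rightarrow> (real ^ 'n \<Rightarrow> real) \<Rightarrow> real" where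
  "wint_norm \<Omega> \<omega> = wint \<Omega> \<omega> (\<lambda>_. 1)"

definition l1_norm :: "real Matrix.vec \<Rightarrow> real" where
  "l1_norm v = (\<Sum>i<dim_vec v. \<bar>v $ i\<bar>)"


definition monomial :: "('n \<Rightarrow> nat) \<Rightarrow> real ^ 'n \<Rightarrow> real" where
  "monomial a y = (\<Prod>i\<in>UNIV. vec_nth y i ^ a i)"

text \<open>
  \<open>poly_space \<Omega> d\<close> is the space of polynomials of total degree at most \<open>d\<close>, viewed as functions
  on \<open>\<Omega>\<close>: the values of its members outside \<open>\<Omega>\<close> are irrelevant.
\<close>

definition poly_space :: "(real ^ 'n) set \<Rightarrow> nat \<Rightarrow> (real ^ 'n \<Rightarrow> real) set" where
  "poly_space \<Omega> d =
     {f. \<exists>c. \<forall>y\<in>\<Omega>. f y = (\<Sum>a | (\<Sum>i\<in>UNIV. a i) \<le> d. c a * monomial a y)}"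

definition poly_basis :: "(real ^ 'n) set \<Rightarrow> nat \<Rightarrow> nat \<Rightarrow> (nat \<Rightarrow> real ^ 'n \<Rightarrow> real) \<Rightarrow> bool" where
  "poly_basis \<Omega> d K p \<longleftrightarrow>
     (\<forall>k<K. p k \<in> poly_space \<Omega> d) \<and>
     (\<forall>c. (\<forall>y\<in>\<Omega>. (\<Sum>k<K. c k * p k y) = 0) \<longrightarrow> (\<forall>k<K. c k = 0)) \<and>
     (\<forall>q\<in>poly_space \<Omega> d. \<exists>c. \<forall>y\<in>\<Omega>. q y = (\<Sum>k<K. c k * p k y))"


definition rbf ::
  "(real \<Rightarrow> real) \<Rightarrow> (nat \<Rightarrow> real) \<Rightarrow> (nat \<Rightarrow> real ^ 'n) \<Rightarrow> nat \<Rightarrow> real ^ 'n \<Rightarrow> real" where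
  "rbf \<phi> \<epsilon> x n y = \<phi> (\<epsilon> n * norm (y - x n))"

text \<open>
  Orientation of \<open>\<Phi> = (\<phi>\<^sub>j(x\<^sub>i))\<close>: the row index is the kernel \<open>j\<close> and the column index is the
  point \<open>i\<close>. If \<open>\<Phi>\<close> is symmetric, e.g. if all shape parameters agree, the orientation is
  immaterial; it also does not affect the rank. For unequal shape parameters it does affect
  \<open>B = \<Phi>\<^sup>-\<^sup>1 P (P\<^sup>T \<Phi>\<^sup>-\<^sup>1 P)\<^sup>-\<^sup>1\<close>, and \<open>B\<close> has its purpose, the identity
  \<open>c(y) = c'(y) - B \<tau>(y)\<close> between the augmented cardinal functions \<open>c\<close> and the pure ones \<open>c'\<close>,
  only with the present orientation. With the other one the equivalence of the two stability
  properties fails.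
\<close>

definition Phi_mat ::
  "nat \<Rightarrow> (real \<Rightarrow> real) \<Rightarrow> (nat \<Rightarrow> real) \<Rightarrow> (nat \<Rightarrow> real ^ 'n) \<Rightarrow> real Matrix.mat" where
  "Phi_mat N \<phi> \<epsilon> x = Matrix.mat N N (\<lambda>(j, i). rbf \<phi> \<epsilon> x j (x i))"

definition P_mat ::
  "nat \<Rightarrow> nat \<Rightarrow> (nat \<Rightarrow> real ^ 'n \<Rightarrow> real) \<Rightarrow> (nat \<Rightarrow> real ^ 'n) \<Rightarrow> real Matrix.mat" where
  "P_mat N K p x = Matrix.mat N K (\<lambda>(n, k). p k (x n))"

text \<open>The inverse; meaningful only for invertible matrices.\<close>

definition minv :: "real Matrix.mat \<Rightarrow> real Matrix.mat" where
  "minv A = the (mat_inverse A)"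

text \<open>The matrix \<open>P\<^sup>T \<Phi>\<^sup>-\<^sup>1 P\<close>.\<close>

definition S_mat ::
  "nat \<Rightarrow> nat \<Rightarrow> (real \<Rightarrow> real) \<Rightarrow> (nat \<Rightarrow> real) \<Rightarrow> (nat \<Rightarrow> real ^ 'n \<Rightarrow> real)
     \<Rightarrow> (nat \<Rightarrow> real ^ 'n) \<Rightarrow> real Matrix.mat" where
  "S_mat N K \<phi> \<epsilon> p x = transpose_mat (P_mat N K p x) * minv (Phi_mat N \<phi> \<epsilon> x) * P_mat N K p x"

definition B_mat ::
  "nat \<Rightarrow> nat \<Rightarrow> (real \<Rightarrow> real) \<Rightarrow> (nat \<Rightarrow> real) \<Rightarrow> (nat \<Rightarrow> real ^ 'n \<Rightarrow> real)
     \<Rightarrow> (nat \<Rightarrow> real ^ 'n) \<Rightarrow> real Matrix.mat" where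
  "B_mat N K \<phi> \<epsilon> p x = minv (Phi_mat N \<phi> \<epsilon> x) * P_mat N K p x * minv (S_mat N K \<phi> \<epsilon> p x)"


text \<open>
  The coefficients of the cardinal functions are the unique solutions of the defining linear
  conditions. These descriptions are meaningful when the interpolation problems are uniquely
  solvable, in particular when \<open>\<Phi>\<close> and \<open>P\<^sup>T \<Phi>\<^sup>-\<^sup>1 P\<close> are invertible.
\<close>

definition pure_coeffs ::
  "nat \<Rightarrow> (real \<Rightarrow> real) \<Rightarrow> (nat \<Rightarrow> real) \<Rightarrow> (nat \<Rightarrow> real ^ 'n) \<Rightarrow> nat \<Rightarrow> real Matrix.vec" where
  "pure_coeffs N \<phi> \<epsilon> x m =
     (THE \<alpha>. \<alpha> \<in> carrier_vec N \<and>
        (\<forall>n<N. (\<Sum>j<N. \<alpha> $ j * rbf \<phi> \<epsilon> x j (x n)) = (if n = m then 1 else 0)))"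

definition pure_cardinal ::
  "nat \<Rightarrow> (real \<Rightarrow> real) \<Rightarrow> (nat \<Rightarrow> real) \<Rightarrow> (nat \<Rightarrow> real ^ 'n) \<Rightarrow> nat \<Rightarrow> real ^ 'n \<Rightarrow> real" where
  "pure_cardinal N \<phi> \<epsilon> x m y = (\<Sum>j<N. pure_coeffs N \<phi> \<epsilon> x m $ j * rbf \<phi> \<epsilon> x j y)"

definition aug_coeffs ::
  "nat \<Rightarrow> nat \<Rightarrow> (real \<Rightarrow> real) \<Rightarrow> (nat \<Rightarrow> real) \<Rightarrow> (nat \<Rightarrow> real ^ 'n \<Rightarrow> real)
     \<Rightarrow> (nat \<Rightarrow> real ^ 'n) \<Rightarrow> nat \<Rightarrow> real Matrix.vec \<times> real Matrix.vec" where
  "aug_coeffs N K \<phi> \<epsilon> p x m =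
     (THE (\<alpha>, \<beta>). \<alpha> \<in> carrier_vec N \<and> \<beta> \<in> carrier_vec K \<and>
        (\<forall>n<N. (\<Sum>j<N. \<alpha> $ j * rbf \<phi> \<epsilon> x j (x n)) + (\<Sum>k<K. \<beta> $ k * p k (x n))
                 = (if n = m then 1 else 0)) \<and>
        (\<forall>k<K. (\<Sum>n<N. \<alpha> $ n * p k (x n)) = 0))"

definition aug_cardinal ::
  "nat \<Rightarrow> nat \<Rightarrow> (real \<Rightarrow> real) \<Rightarrow> (nat \<Rightarrow> real) \<Rightarrow> (nat \<Rightarrow> real ^ 'n \<Rightarrow> real)
     \<Rightarrow> (nat \<Rightarrow> real ^ 'n) \<Rightarrow> nat \<Rightarrow> real ^ 'n \<Rightarrow> real" where
  "aug_cardinal N K \<phi> \<epsilon> p x m y =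
     (\<Sum>j<N. fst (aug_coeffs N K \<phi> \<epsilon> p x m) $ j * rbf \<phi> \<epsilon> x j y)
     + (\<Sum>k<K. snd (aug_coeffs N K \<phi> \<epsilon> p x m) $ k * p k y)"

definition pure_weights ::
  "(real ^ 'n) set \<Rightarrow> (real ^ 'n \<Rightarrow> real) \<Rightarrow> nat \<Rightarrow> (real \<Rightarrow> real) \<Rightarrow> (nat \<Rightarrow> real)
     \<Rightarrow> (nat \<Rightarrow> real ^ 'n) \<Rightarrow> real Matrix.vec" where
  "pure_weights \<Omega> \<omega> N \<phi> \<epsilon> x = Matrix.vec N (\<lambda>m. wint \<Omega> \<omega> (pure_cardinal N \<phi> \<epsilon> x m))"

definition aug_weights ::
  "(real ^ 'n) set \<Rightarrow> (real ^ 'n \<Rightarrow> real) \<Rightarrow> nat \<Rightarrow> nat \<Rightarrow> (real \<Rightarrow> real) \<Rightarrow> (nat \<Rightarrow> real)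
     \<Rightarrow> (nat \<Rightarrow> real ^ 'n \<Rightarrow> real) \<Rightarrow> (nat \<Rightarrow> real ^ 'n) \<Rightarrow> real Matrix.vec" where
  "aug_weights \<Omega> \<omega> N K \<phi> \<epsilon> p x =
     Matrix.vec N (\<lambda>m. wint \<Omega> \<omega> (aug_cardinal N K \<phi> \<epsilon> p x m))"

definition tau ::
  "nat \<Rightarrow> nat \<Rightarrow> (real \<Rightarrow> real) \<Rightarrow> (nat \<Rightarrow> real) \<Rightarrow> (nat \<Rightarrow> real ^ 'n \<Rightarrow> real)
     \<Rightarrow> (nat \<Rightarrow> real ^ 'n) \<Rightarrow> real ^ 'n \<Rightarrow> real Matrix.vec" where
  "tau N K \<phi> \<epsilon> p x y =
     transpose_mat (P_mat N K p x) *\<^sub>v Matrix.vec N (\<lambda>m. pure_cardinal N \<phi> \<epsilon> x m y)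
     - Matrix.vec K (\<lambda>k. p k y)"

end

theory Submission
  imports Defs
begin

text \<open>
  The two families of cardinal functions differ by exactly the vector that the hypothesis
  controls. Let \<open>\<phi>(y)\<close> be the vector of kernel values, \<open>c'(y) = \<Phi>\<^sup>-\<^sup>1 \<phi>(y)\<close> the vector of pure
  cardinal functions, and \<open>\<alpha>\<close>, \<open>\<beta>\<close> the coefficients of the augmented function \<open>c\<^sub>m\<close>. The
  interpolation conditions say \<open>\<Phi>\<^sup>T \<alpha> = e\<^sub>m - P \<beta>\<close>; pairing this with \<open>c'(y)\<close> gives
  \<open>\<alpha> \<cdot> \<phi>(y) = c'\<^sub>m(y) - \<beta> \<cdot> P\<^sup>T c'(y)\<close>, hence \<open>c\<^sub>m(y) = c'\<^sub>m(y) - \<beta> \<cdot> \<tau>(y)\<close>. Eliminating \<open>\<alpha>\<close>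
  through the moment conditions \<open>P\<^sup>T \<alpha> = 0\<close> identifies \<open>\<beta>\<close> as row \<open>m\<close> of \<open>B\<close>. So
  \<open>c(y) = c'(y) - B \<tau>(y)\<close> (lemma \<open>pure_minus_aug_cardinal\<close>).

  Integrating against the essentially bounded weight \<open>\<omega>\<close> shows that the \<open>\<ell>\<^sup>1\<close> norms of the two
  weight vectors differ by at most \<open>C\<close> times the integral of the \<open>\<ell>\<^sup>1\<close> norm of \<open>B \<tau>(y)\<close>, where \<open>C\<close> bounds
  \<open>\<bar>\<omega>\<bar>\<close> (lemma \<open>l1_norm_wint_diff_le\<close>). This difference tends to \<open>0\<close>, so either both norms
  converge to a given limit or neither does.
\<close>

section \<open>Linear systems with an invertible matrix\<close>

lemma minv_inverse:
  assumes A: "A \<in> carrier_mat n n" and inv: "invertible_mat A"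
  shows "minv A \<in> carrier_mat n n" "A * minv A = 1\<^sub>m n" "minv A * A = 1\<^sub>m n"
proof -
  obtain B where B: "A * B = 1\<^sub>m n" "B * A = 1\<^sub>m (dim_row B)"
    using inv A unfolding invertible_mat_def inverts_mat_def by auto
  have dims: "dim_col B = n" "dim_row B = n"
    using arg_cong[OF B(1), of dim_col] arg_cong[OF B(2), of dim_col] A by auto
  then have Bc: "B \<in> carrier_mat n n" by auto
  have "A \<in> Units (ring_mat TYPE(real) n ())"
    unfolding Units_def ring_mat_def using A B Bc dims by auto
  then obtain C where C: "mat_inverse A = Some C"
    using mat_inverse(1)[OF A, of "()"] by (cases "mat_inverse A") auto
  then show "minv A \<in> carrier_mat n n" "A * minv A = 1\<^sub>m n" "minv A * A = 1\<^sub>m n"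
    using mat_inverse(2)[OF A C] by (auto simp: minv_def)
qed

lemma transpose_solve_iff:
  assumes A: "A \<in> carrier_mat n n" and inv: "invertible_mat A"
    and v: "v \<in> carrier_vec n" and b: "b \<in> carrier_vec n"
  shows "transpose_mat A *\<^sub>v v = b \<longleftrightarrow> v = transpose_mat (minv A) *\<^sub>v b"
proof -
  note Q = minv_inverse[OF A inv]
  have 1: "transpose_mat A * transpose_mat (minv A) = 1\<^sub>m n"
    using transpose_mult[OF Q(1) A] Q(3) by simp
  have 2: "transpose_mat (minv A) * transpose_mat A = 1\<^sub>m n"
    using transpose_mult[OF A Q(1)] Q(2) by simp
  have "transpose_mat A *\<^sub>v (transpose_mat (minv A) *\<^sub>v b) = b"
    using assoc_mult_mat_vec[of "transpose_mat A" n n "transpose_mat (minv A)" n b] 1 A Q(1) b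
    by simp
  moreover have "transpose_mat (minv A) *\<^sub>v (transpose_mat A *\<^sub>v v) = v"
    using assoc_mult_mat_vec[of "transpose_mat (minv A)" n n "transpose_mat A" n v] 2 A Q(1) v
    by simp
  ultimately show ?thesis by auto
qed

text \<open>
  The saddle-point system of the augmented interpolation problem. The first equation gives
  \<open>\<alpha> = M\<^sup>-\<^sup>T (r - P \<beta>)\<close>; inserting this into \<open>P\<^sup>T \<alpha> = 0\<close> leaves \<open>S\<^sup>T \<beta> = P\<^sup>T M\<^sup>-\<^sup>T r\<close> with the
  Schur complement \<open>S = P\<^sup>T M\<^sup>-\<^sup>1 P\<close>.
\<close>

lemma saddle_point_solve_iff:
  fixes M P :: "real mat"
  assumes M: "M \<in> carrier_mat n n" "invertible_mat M" and P: "P \<in> carrier_mat n k"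
    and S_def: "S = transpose_mat P * minv M * P" and S: "invertible_mat S"
    and a: "\<alpha> \<in> carrier_vec n" and b: "\<beta> \<in> carrier_vec k" and r: "r \<in> carrier_vec n"
  shows "transpose_mat M *\<^sub>v \<alpha> + P *\<^sub>v \<beta> = r \<and> transpose_mat P *\<^sub>v \<alpha> = 0\<^sub>v k \<longleftrightarrow>
    \<alpha> = transpose_mat (minv M) *\<^sub>v (r - P *\<^sub>v \<beta>) \<and>
    \<beta> = transpose_mat (minv M * P * minv S) *\<^sub>v r"
proof -
  let ?Qt = "transpose_mat (minv M)" and ?Pt = "transpose_mat P"
  note Q = minv_inverse[OF M]
  have Sc: "S \<in> carrier_mat k k" using P Q(1) by (auto simp: S_def)
  note S' = minv_inverse[OF Sc S]
  have Pb: "P *\<^sub>v \<beta> \<in> carrier_vec n" using P b by auto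
  have first: "transpose_mat M *\<^sub>v \<alpha> + P *\<^sub>v \<beta> = r \<longleftrightarrow> \<alpha> = ?Qt *\<^sub>v (r - P *\<^sub>v \<beta>)"
  proof -
    have "transpose_mat M *\<^sub>v \<alpha> + P *\<^sub>v \<beta> = r \<longleftrightarrow> transpose_mat M *\<^sub>v \<alpha> = r - P *\<^sub>v \<beta>"
      using M(1) a Pb r P by (auto simp: Matrix.vec_eq_iff)
    then show ?thesis
      using transpose_solve_iff[OF M a, of "r - P *\<^sub>v \<beta>"] r Pb by auto
  qed
  have St: "transpose_mat S = ?Pt * ?Qt * P"
    using P Q(1) by (simp add: S_def transpose_mult[of _ k n _ k] transpose_mult[of _ n n _ k]
      transpose_mult[of _ k n _ n]
      assoc_mult_mat[of "?Pt" k n "?Qt" n P k])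
  have Bt: "transpose_mat (minv M * P * minv S) *\<^sub>v r
      = transpose_mat (minv S) *\<^sub>v (?Pt *\<^sub>v (?Qt *\<^sub>v r))"
    using P Q(1) S'(1) r by (simp add: transpose_mult[of _ n k _ k] transpose_mult[of _ n n _ k]
      assoc_mult_mat_vec[of _ k k _ n] assoc_mult_mat_vec[of _ k n _ n])
  have expand: "?Pt *\<^sub>v (?Qt *\<^sub>v (r - P *\<^sub>v \<beta>)) = ?Pt *\<^sub>v (?Qt *\<^sub>v r) - transpose_mat S *\<^sub>v \<beta>"
    using P Q(1) r b Pb unfolding St
    by (simp add: mult_minus_distrib_mat_vec[of _ n n] mult_minus_distrib_mat_vec[of _ k n]
      assoc_mult_mat_vec[of _ k n _ k] assoc_mult_mat_vec[of _ k n _ n])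
  have rc: "?Pt *\<^sub>v (?Qt *\<^sub>v r) \<in> carrier_vec k" using P by (intro carrier_vecI) simp
  have "?Pt *\<^sub>v (?Qt *\<^sub>v (r - P *\<^sub>v \<beta>)) = 0\<^sub>v k \<longleftrightarrow> transpose_mat S *\<^sub>v \<beta> = ?Pt *\<^sub>v (?Qt *\<^sub>v r)"
    unfolding expand using rc Sc P by (auto simp: Matrix.vec_eq_iff)
  also have "\<dots> \<longleftrightarrow> \<beta> = transpose_mat (minv M * P * minv S) *\<^sub>v r"
    unfolding Bt by (rule transpose_solve_iff[OF Sc S b rc])
  finally show ?thesis using first by auto
qed

section \<open>Pure and augmented cardinal functions\<close>

lemma Phi_mat_carrier [simp]: "Phi_mat N \<phi> \<epsilon> x \<in> carrier_mat N N"
  and P_mat_carrier [simp]: "P_mat N K p x \<in> carrier_mat N K"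
  by (auto simp: Phi_mat_def P_mat_def)

lemma pure_coeffs_eq:
  assumes inv: "invertible_mat (Phi_mat N \<phi> \<epsilon> x)" and m: "m < N"
  shows "pure_coeffs N \<phi> \<epsilon> x m = row (minv (Phi_mat N \<phi> \<epsilon> x)) m"
proof -
  let ?M = "Phi_mat N \<phi> \<epsilon> x"
  note Q = minv_inverse[OF Phi_mat_carrier inv]
  have e: "transpose_mat (minv ?M) *\<^sub>v unit_vec N m = row (minv ?M) m"
    using Q(1) m by (auto simp: Matrix.vec_eq_iff)
  have sys: "(\<forall>n<N. (\<Sum>j<N. \<alpha> $ j * rbf \<phi> \<epsilon> x j (x n)) = (if n = m then 1 else 0))
      \<longleftrightarrow> transpose_mat ?M *\<^sub>v \<alpha> = unit_vec N m" if "\<alpha> \<in> carrier_vec N" for \<alpha>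
    using that m
    by (auto simp: Matrix.vec_eq_iff Phi_mat_def scalar_prod_def lessThan_atLeast0 mult.commute)
  have "\<alpha> \<in> carrier_vec N \<and>
      (\<forall>n<N. (\<Sum>j<N. \<alpha> $ j * rbf \<phi> \<epsilon> x j (x n)) = (if n = m then 1 else 0))
      \<longleftrightarrow> \<alpha> = row (minv ?M) m" for \<alpha>
    using sys[of \<alpha>] transpose_solve_iff[OF Phi_mat_carrier inv, of \<alpha> "unit_vec N m"] Q(1) m
    unfolding e by auto
  then show ?thesis unfolding pure_coeffs_def by simp
qed

text \<open>Each kernel lies in the span of the kernels and is therefore its own interpolant.\<close>

lemma Phi_mat_mult_pure_cardinal:
  assumes inv: "invertible_mat (Phi_mat N \<phi> \<epsilon> x)"
  shows "Phi_mat N \<phi> \<epsilon> x *\<^sub>v Matrix.vec N (\<lambda>m. pure_cardinal N \<phi> \<epsilon> x m y)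
    = Matrix.vec N (\<lambda>j. rbf \<phi> \<epsilon> x j y)"
proof -
  let ?M = "Phi_mat N \<phi> \<epsilon> x" and ?f = "Matrix.vec N (\<lambda>j. rbf \<phi> \<epsilon> x j y)"
  note Q = minv_inverse[OF Phi_mat_carrier inv]
  have "Matrix.vec N (\<lambda>m. pure_cardinal N \<phi> \<epsilon> x m y) = minv ?M *\<^sub>v ?f"
    using Q(1) by (auto simp: Matrix.vec_eq_iff pure_cardinal_def pure_coeffs_eq[OF inv]
        scalar_prod_def lessThan_atLeast0)
  moreover have "?M *\<^sub>v (minv ?M *\<^sub>v ?f) = ?f"
    using assoc_mult_mat_vec[of ?M N N "minv ?M" N ?f] Q by simp
  ultimately show ?thesis by simp
qed

lemma S_mat_carrier:
  assumes "invertible_mat (Phi_mat N \<phi> \<epsilon> x)"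
  shows "S_mat N K \<phi> \<epsilon> p x \<in> carrier_mat K K"
  unfolding S_mat_def using minv_inverse(1)[OF Phi_mat_carrier assms]
  by (intro mult_carrier_mat[of _ K N]) auto

lemma B_mat_carrier:
  assumes "invertible_mat (Phi_mat N \<phi> \<epsilon> x)" "invertible_mat (S_mat N K \<phi> \<epsilon> p x)"
  shows "B_mat N K \<phi> \<epsilon> p x \<in> carrier_mat N K"
  unfolding B_mat_def
  using minv_inverse(1)[OF Phi_mat_carrier assms(1)]
    minv_inverse(1)[OF S_mat_carrier[OF assms(1)] assms(2)]
  by (intro mult_carrier_mat[of _ N K] mult_carrier_mat[of _ N N]) auto

lemma aug_coeffs_eqs:
  assumes inv: "invertible_mat (Phi_mat N \<phi> \<epsilon> x)" "invertible_mat (S_mat N K \<phi> \<epsilon> p x)"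
    and m: "m < N" and ab: "aug_coeffs N K \<phi> \<epsilon> p x m = (\<alpha>, \<beta>)"
  shows "\<alpha> \<in> carrier_vec N" "\<beta> = row (B_mat N K \<phi> \<epsilon> p x) m"
    "transpose_mat (Phi_mat N \<phi> \<epsilon> x) *\<^sub>v \<alpha> + P_mat N K p x *\<^sub>v \<beta> = unit_vec N m"
proof -
  let ?M = "Phi_mat N \<phi> \<epsilon> x" and ?P = "P_mat N K p x" and ?B = "B_mat N K \<phi> \<epsilon> p x"
  let ?\<beta> = "row ?B m"
  let ?\<alpha> = "transpose_mat (minv ?M) *\<^sub>v (unit_vec N m - ?P *\<^sub>v ?\<beta>)"
  note Q = minv_inverse[OF Phi_mat_carrier inv(1)]
  note Bc = B_mat_carrier[OF inv]
  have e: "transpose_mat ?B *\<^sub>v unit_vec N m = ?\<beta>"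
    using Bc m by (auto simp: Matrix.vec_eq_iff)
  note solve = saddle_point_solve_iff[OF Phi_mat_carrier inv(1) P_mat_carrier S_mat_def inv(2),
      of _ _ "unit_vec N m", folded B_mat_def, unfolded e, simplified]
  \<comment> \<open>\<open>\<Phi>\<close> has the kernels as rows, so the interpolation conditions involve its transpose.\<close>
  have sys: "(\<forall>n<N. (\<Sum>j<N. a $ j * rbf \<phi> \<epsilon> x j (x n)) + (\<Sum>k<K. b $ k * p k (x n))
        = (if n = m then 1 else 0)) \<and> (\<forall>k<K. (\<Sum>n<N. a $ n * p k (x n)) = 0)
      \<longleftrightarrow> transpose_mat ?M *\<^sub>v a + ?P *\<^sub>v b = unit_vec N m \<and> transpose_mat ?P *\<^sub>v a = 0\<^sub>v K"
    if "a \<in> carrier_vec N" "b \<in> carrier_vec K" for a b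
    using that m by (auto simp: Matrix.vec_eq_iff Phi_mat_def P_mat_def scalar_prod_def
        lessThan_atLeast0 mult.commute)
  have ac: "?\<alpha> \<in> carrier_vec N" and bc: "?\<beta> \<in> carrier_vec K"
    using Q(1) Bc by (auto intro!: carrier_vecI)
  have "(\<lambda>(a, b). a \<in> carrier_vec N \<and> b \<in> carrier_vec K \<and>
        (\<forall>n<N. (\<Sum>j<N. a $ j * rbf \<phi> \<epsilon> x j (x n)) + (\<Sum>k<K. b $ k * p k (x n))
          = (if n = m then 1 else 0)) \<and> (\<forall>k<K. (\<Sum>n<N. a $ n * p k (x n)) = 0))
      = (\<lambda>z. z = (?\<alpha>, ?\<beta>))"
  proof (rule ext, clarify)
    fix a b
    show "(a \<in> carrier_vec N \<and> b \<in> carrier_vec K \<and>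
        (\<forall>n<N. (\<Sum>j<N. a $ j * rbf \<phi> \<epsilon> x j (x n)) + (\<Sum>k<K. b $ k * p k (x n))
          = (if n = m then 1 else 0)) \<and> (\<forall>k<K. (\<Sum>n<N. a $ n * p k (x n)) = 0))
      = ((a, b) = (?\<alpha>, ?\<beta>))"
    proof (cases "a \<in> carrier_vec N \<and> b \<in> carrier_vec K")
      case True
      then show ?thesis using sys[of a b] solve[of a b] by auto
    next
      case False
      then show ?thesis using ac bc by auto
    qed
  qed
  then have "aug_coeffs N K \<phi> \<epsilon> p x m = (?\<alpha>, ?\<beta>)" unfolding aug_coeffs_def by simp
  then have eqs: "\<alpha> = ?\<alpha>" "\<beta> = ?\<beta>" unfolding ab by (blast elim: Pair_inject)+
  show "\<alpha> \<in> carrier_vec N" unfolding eqs(1) by (rule ac)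
  show "\<beta> = ?\<beta>" by (rule eqs(2))
  show "transpose_mat ?M *\<^sub>v \<alpha> + ?P *\<^sub>v \<beta> = unit_vec N m"
    using solve[OF ac bc] unfolding eqs by simp
qed

text \<open>
  Pair the interpolation conditions \<open>\<Phi>\<^sup>T \<alpha> + P \<beta> = e\<^sub>m\<close> with the vector \<open>c'(y)\<close> and move the
  matrices to the other side of the scalar product: \<open>\<Phi> c'(y)\<close> is the vector of kernel values, and
  the term \<open>P\<^sup>T c'(y)\<close> combines with the polynomial part of \<open>c\<^sub>m\<close> to \<open>\<tau>(y)\<close>.
\<close>

lemma pure_minus_aug_cardinal:
  assumes inv: "invertible_mat (Phi_mat N \<phi> \<epsilon> x)" "invertible_mat (S_mat N K \<phi> \<epsilon> p x)"
    and m: "m < N"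
  shows "pure_cardinal N \<phi> \<epsilon> x m y - aug_cardinal N K \<phi> \<epsilon> p x m y
    = (B_mat N K \<phi> \<epsilon> p x *\<^sub>v tau N K \<phi> \<epsilon> p x y) $ m"
proof -
  let ?M = "Phi_mat N \<phi> \<epsilon> x" and ?P = "P_mat N K p x" and ?B = "B_mat N K \<phi> \<epsilon> p x"
  let ?c = "Matrix.vec N (\<lambda>m. pure_cardinal N \<phi> \<epsilon> x m y)"
  let ?f = "Matrix.vec N (\<lambda>j. rbf \<phi> \<epsilon> x j y)" and ?p = "Matrix.vec K (\<lambda>k. p k y)"
  obtain \<alpha> \<beta> where ab: "aug_coeffs N K \<phi> \<epsilon> p x m = (\<alpha>, \<beta>)" by fastforce
  note eqs = aug_coeffs_eqs[OF inv m ab]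
  have dB: "dim_row ?B = N" "dim_col ?B = K"
    using B_mat_carrier[OF inv] by auto
  then have bc: "\<beta> \<in> carrier_vec K" by (simp add: eqs(2) carrier_vecI)
  have aug: "aug_cardinal N K \<phi> \<epsilon> p x m y = \<alpha> \<bullet> ?f + \<beta> \<bullet> ?p"
    by (simp add: aug_cardinal_def ab scalar_prod_def lessThan_atLeast0)
  have "pure_cardinal N \<phi> \<epsilon> x m y = unit_vec N m \<bullet> ?c" using m by simp
  also have "\<dots> = (transpose_mat ?M *\<^sub>v \<alpha>) \<bullet> ?c + (?P *\<^sub>v \<beta>) \<bullet> ?c"
    unfolding eqs(3)[symmetric]
    by (rule add_scalar_prod_distrib[of _ N]) (auto intro!: carrier_vecI simp: Phi_mat_def P_mat_def)
  also have "(transpose_mat ?M *\<^sub>v \<alpha>) \<bullet> ?c = \<alpha> \<bullet> ?f"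
    using transpose_vec_mult_scalar[OF Phi_mat_carrier[of N \<phi> \<epsilon> x] _ eqs(1), of ?c]
      Phi_mat_mult_pure_cardinal[OF inv(1), of y]
    by simp
  also have "(?P *\<^sub>v \<beta>) \<bullet> ?c = \<beta> \<bullet> (transpose_mat ?P *\<^sub>v ?c)"
    using transpose_vec_mult_scalar[of "transpose_mat ?P" K N ?c \<beta>] bc by simp
  finally have "pure_cardinal N \<phi> \<epsilon> x m y - aug_cardinal N K \<phi> \<epsilon> p x m y
      = \<beta> \<bullet> (transpose_mat ?P *\<^sub>v ?c) - \<beta> \<bullet> ?p"
    by (simp add: aug)
  also have "\<dots> = \<beta> \<bullet> tau N K \<phi> \<epsilon> p x y"
    unfolding tau_def by (rule scalar_prod_minus_distrib[symmetric, of _ K])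
      (use bc in \<open>auto intro!: carrier_vecI simp: P_mat_def\<close>)
  finally show ?thesis using dB m by (simp add: eqs(2))
qed

section \<open>Integrability and comparison of weights\<close>

lemma poly_space_integrable:
  assumes om: "open \<Omega>" "bounded \<Omega>" and f: "f \<in> poly_space \<Omega> d"
  shows "integrable (lebesgue_on \<Omega>) f"
proof -
  have lm: "\<Omega> \<in> lmeasurable" using om by (rule lmeasurable_open[rotated])
  obtain c where c: "\<And>y. y \<in> \<Omega> \<Longrightarrow> f y = (\<Sum>a | (\<Sum>i\<in>UNIV. a i) \<le> d. c a * monomial a y)"
    using f by (auto simp: poly_space_def)
  define g where "g y = (\<Sum>a | (\<Sum>i\<in>UNIV. a i) \<le> d. c a * monomial a y)" for y
  have cont: "continuous_on A g" for A
    unfolding g_def monomial_def by (intro continuous_intros)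
  have "bounded (g ` closure \<Omega>)"
    using om(2) by (intro compact_imp_bounded compact_continuous_image cont) (simp add: compact_closure)
  then obtain b where b: "\<And>y. y \<in> closure \<Omega> \<Longrightarrow> norm (g y) \<le> b"
    by (auto simp: bounded_iff)
  interpret finite_measure "lebesgue_on \<Omega>"
    using lm by (intro finite_measureI) (auto simp: emeasure_restrict_space fmeasurable_def)
  have "integrable (lebesgue_on \<Omega>) g"
  proof (rule integrable_const_bound[of _ b])
    show "AE y in lebesgue_on \<Omega>. norm (g y) \<le> b"
      using b closure_subset by (intro AE_I2) auto
    show "g \<in> borel_measurable (lebesgue_on \<Omega>)"
      using cont lm by (intro continuous_imp_measurable_on_sets_lebesgue) auto
  qed
  then show ?thesis
    by (rule iffD1[OF Bochner_Integration.integrable_cong, rotated 2]) (auto simp: c g_def)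
qed

text \<open>
  The reverse triangle inequality for the \<open>\<ell>\<^sup>1\<close> norm, with each component bounded by the
  \<open>L\<^sup>1\<close>--\<open>L\<^sup>\<infinity>\<close> Hoelder inequality.
\<close>

lemma l1_norm_wint_diff_le:
  assumes \<omega>: "\<omega> \<in> borel_measurable (lebesgue_on \<Omega>)" "AE y in lebesgue_on \<Omega>. \<bar>\<omega> y\<bar> \<le> C"
    and f: "\<And>m. m < N \<Longrightarrow> integrable (lebesgue_on \<Omega>) (f m)"
    and g: "\<And>m. m < N \<Longrightarrow> integrable (lebesgue_on \<Omega>) (g m)"
  shows "\<bar>l1_norm (Matrix.vec N (\<lambda>m. wint \<Omega> \<omega> (f m))) - l1_norm (Matrix.vec N (\<lambda>m. wint \<Omega> \<omega> (g m)))\<bar>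
    \<le> C * (LINT y|lebesgue_on \<Omega>. (\<Sum>m<N. \<bar>f m y - g m y\<bar>))"
proof -
  have int: "integrable (lebesgue_on \<Omega>) (\<lambda>y. h y * \<omega> y)"
    if h: "integrable (lebesgue_on \<Omega>) h" for h
  proof (rule Bochner_Integration.integrable_bound)
    show "integrable (lebesgue_on \<Omega>) (\<lambda>y. h y * C)" using h by simp
    show "(\<lambda>y. h y * \<omega> y) \<in> borel_measurable (lebesgue_on \<Omega>)" using h \<omega>(1) by measurable
    show "AE y in lebesgue_on \<Omega>. norm (h y * \<omega> y) \<le> norm (h y * C)"
      using \<omega>(2) by eventually_elim (auto simp: abs_mult intro!: mult_left_mono)
  qed
  have comp: "\<bar>wint \<Omega> \<omega> (f m) - wint \<Omega> \<omega> (g m)\<bar> \<le> C * (LINT y|lebesgue_on \<Omega>. \<bar>f m y - g m y\<bar>)"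
    if m: "m < N" for m
  proof -
    have "wint \<Omega> \<omega> (f m) - wint \<Omega> \<omega> (g m) = (LINT y|lebesgue_on \<Omega>. (f m y - g m y) * \<omega> y)"
      unfolding wint_def using int[OF f[OF m]] int[OF g[OF m]] by (simp add: left_diff_distrib)
    also have "\<bar>\<dots>\<bar> \<le> (LINT y|lebesgue_on \<Omega>. \<bar>(f m y - g m y) * \<omega> y\<bar>)"
      by (rule integral_abs_bound)
    also have "\<dots> \<le> (LINT y|lebesgue_on \<Omega>. C * \<bar>f m y - g m y\<bar>)"
    proof (rule integral_mono_AE)
      show "integrable (lebesgue_on \<Omega>) (\<lambda>y. \<bar>(f m y - g m y) * \<omega> y\<bar>)"
        using int[of "\<lambda>y. f m y - g m y"] f[OF m] g[OF m] by auto
      show "integrable (lebesgue_on \<Omega>) (\<lambda>y. C * \<bar>f m y - g m y\<bar>)"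
        using f[OF m] g[OF m] by auto
      show "AE y in lebesgue_on \<Omega>. \<bar>(f m y - g m y) * \<omega> y\<bar> \<le> C * \<bar>f m y - g m y\<bar>"
        using \<omega>(2) by eventually_elim (simp add: abs_mult mult.commute mult_right_mono)
    qed
    finally show ?thesis by simp
  qed
  have "\<bar>l1_norm (Matrix.vec N (\<lambda>m. wint \<Omega> \<omega> (f m))) - l1_norm (Matrix.vec N (\<lambda>m. wint \<Omega> \<omega> (g m)))\<bar>
      = \<bar>\<Sum>m<N. (\<bar>wint \<Omega> \<omega> (f m)\<bar> - \<bar>wint \<Omega> \<omega> (g m)\<bar>)\<bar>"
    by (simp add: l1_norm_def sum_subtractf)
  also have "\<dots> \<le> (\<Sum>m<N. \<bar>wint \<Omega> \<omega> (f m) - wint \<Omega> \<omega> (g m)\<bar>)"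
    by (rule order_trans[OF sum_abs]) (intro sum_mono abs_triangle_ineq3)
  also have "\<dots> \<le> (\<Sum>m<N. C * (LINT y|lebesgue_on \<Omega>. \<bar>f m y - g m y\<bar>))"
    by (intro sum_mono comp) simp
  also have "\<dots> = C * (LINT y|lebesgue_on \<Omega>. (\<Sum>m<N. \<bar>f m y - g m y\<bar>))"
    using f g by (subst Bochner_Integration.integral_sum) (auto simp: sum_distrib_left)
  finally show ?thesis .
qed

section \<open>Equivalence of asymptotic stability\<close>

theorem lemma6p1:
  fixes \<Omega> :: "(real ^ 'n) set"
    and \<omega> :: "real ^ 'n \<Rightarrow> real"
    and d K :: nat
    and x :: "nat \<Rightarrow> nat \<Rightarrow> real ^ 'n"
    and \<phi> :: "nat \<Rightarrow> real \<Rightarrow> real"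
    and \<epsilon> :: "nat \<Rightarrow> nat \<Rightarrow> real"
    and p :: "nat \<Rightarrow> nat \<Rightarrow> real ^ 'n \<Rightarrow> real"
  assumes "open \<Omega>" and "connected \<Omega>" and "bounded \<Omega>" and "measure lebesgue \<Omega> > 0"
    and "\<omega> \<in> Linfty \<Omega>"
    and points: "\<And>N n. n < N \<Longrightarrow> x N n \<in> \<Omega>" "\<And>N. inj_on (x N) {..<N}"
    and shape: "\<And>N n. n < N \<Longrightarrow> \<epsilon> N n \<ge> 0"
    and rbf_integrable:
      "\<And>N n. n < N \<Longrightarrow> integrable (lebesgue_on \<Omega>) (rbf (\<phi> N) (\<epsilon> N) (x N) n)"
    and basis: "\<And>N. poly_basis \<Omega> d K (p N)"
    and full_rank:
      "\<forall>\<^sub>F N in sequentially. invertible_mat (Phi_mat N (\<phi> N) (\<epsilon> N) (x N))"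
      "\<forall>\<^sub>F N in sequentially. vec_space.rank N (P_mat N K (p N) (x N)) = K"
    and B_defined:
      "\<forall>\<^sub>F N in sequentially. invertible_mat (S_mat N K (\<phi> N) (\<epsilon> N) (p N) (x N))"
    and B_tau:
      "(\<lambda>N. LINT y|lebesgue_on \<Omega>.
          l1_norm (B_mat N K (\<phi> N) (\<epsilon> N) (p N) (x N) *\<^sub>v tau N K (\<phi> N) (\<epsilon> N) (p N) (x N) y))
        \<longlonglongrightarrow> 0"
  shows "(\<lambda>N. l1_norm (pure_weights \<Omega> \<omega> N (\<phi> N) (\<epsilon> N) (x N))) \<longlonglongrightarrow> wint_norm \<Omega> \<omega>
     \<longleftrightarrow> (\<lambda>N. l1_norm (aug_weights \<Omega> \<omega> N K (\<phi> N) (\<epsilon> N) (p N) (x N))) \<longlonglongrightarrow> wint_norm \<Omega> \<omega>"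
proof -
  let ?L = "\<lambda>N. l1_norm (pure_weights \<Omega> \<omega> N (\<phi> N) (\<epsilon> N) (x N))"
  let ?R = "\<lambda>N. l1_norm (aug_weights \<Omega> \<omega> N K (\<phi> N) (\<epsilon> N) (p N) (x N))"
  let ?T = "\<lambda>N. LINT y|lebesgue_on \<Omega>.
      l1_norm (B_mat N K (\<phi> N) (\<epsilon> N) (p N) (x N) *\<^sub>v tau N K (\<phi> N) (\<epsilon> N) (p N) (x N) y)"
  obtain C where \<omega>: "\<omega> \<in> borel_measurable (lebesgue_on \<Omega>)"
      and C: "AE y in lebesgue_on \<Omega>. \<bar>\<omega> y\<bar> \<le> C"
    using \<open>\<omega> \<in> Linfty \<Omega>\<close> by (auto simp: Linfty_def)
  have poly: "integrable (lebesgue_on \<Omega>) (p N k)" if "k < K" for N k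
    using poly_space_integrable[OF \<open>open \<Omega>\<close> \<open>bounded \<Omega>\<close>] basis[of N] that
    by (auto simp: poly_basis_def)
  have "\<forall>\<^sub>F N in sequentially. norm (?L N - ?R N) \<le> C * ?T N"
    using full_rank(1) B_defined
  proof eventually_elim
    case (elim N)
    have row: "dim_row (B_mat N K (\<phi> N) (\<epsilon> N) (p N) (x N)) = N"
      using B_mat_carrier[OF elim] by auto
    have pure: "integrable (lebesgue_on \<Omega>) (pure_cardinal N (\<phi> N) (\<epsilon> N) (x N) m)" for m
      unfolding pure_cardinal_def using rbf_integrable by (auto intro!: Bochner_Integration.integrable_sum)
    have aug: "integrable (lebesgue_on \<Omega>) (aug_cardinal N K (\<phi> N) (\<epsilon> N) (p N) (x N) m)" for m
      unfolding aug_cardinal_def using rbf_integrable poly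
      by (auto intro!: Bochner_Integration.integrable_sum Bochner_Integration.integrable_add)
    have "l1_norm (B_mat N K (\<phi> N) (\<epsilon> N) (p N) (x N) *\<^sub>v tau N K (\<phi> N) (\<epsilon> N) (p N) (x N) y)
        = (\<Sum>m<N. \<bar>pure_cardinal N (\<phi> N) (\<epsilon> N) (x N) m y
            - aug_cardinal N K (\<phi> N) (\<epsilon> N) (p N) (x N) m y\<bar>)" for y
      using row by (simp add: l1_norm_def pure_minus_aug_cardinal[OF elim] del: index_mult_mat_vec)
    then show ?case
      using l1_norm_wint_diff_le[OF \<omega> C pure aug, of N]
      by (simp add: pure_weights_def aug_weights_def)
  qed
  moreover have "(\<lambda>N. C * ?T N) \<longlonglongrightarrow> 0"
    using tendsto_mult_right_zero[OF B_tau] by simp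
  ultimately have "(\<lambda>N. ?L N - ?R N) \<longlonglongrightarrow> 0"
    by (rule Lim_null_comparison)
  then show ?thesis by (rule Lim_transform_eq)
qed

end
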